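(* For every $f\in\mathcal{F}_d(p)$ (with rational entries), the polynomial $P_f(x)=m(x)f$ is a linear combination (with coefficients in $\mathbb{Q}$) of the fundamental polynomials. In particular it has the form $P_f(x)=Q(x)-R(x)$, where $$Q(x)=\sum_{k=2}^{d-1}\ \sum_{1\le j_1<\cdots<j_k\le d-1}a_{j_1\ldots j_k}\,x_{j_1}\cdots x_{j_k},\qquad a_{j_1\ldots j_k}\in\mathbb{Q},$$ and $R(x)=b_0+\sum_{j=1}^{d-1}b_jx_j$ is the remainder of $Q(x)$ modulo $\mathcal{I}_{\mathcal{P}}$.
   Context: Let $d\ge 2$, $D=2^d$, and let $p=s/t\in\mathbb{Q}$ with positive integers $s,t$ and $0<p\le 1/2$; put $c=(1-p)/p=(t-s)/s$. $\mathcal{F}_d(p)$ is the set of probability mass functions (pmfs) on $\{0,1\}^d$ all of whose univariate marginals are Bernoulli with parameter $p$. A pmf is identified with the column vector $f=(f_1,\ldots,f_D)$, where $f_i$ is the probability of the point $(x_1,\ldots,x_d)\in\{0,1\}^d$ with $i=1+\sum_{k=1}^d x_k2^{k-1}$. For $1\le j\le D/2$ let $m_j(x)=\prod_{k=1}^{d-1}x_k^{\varepsilon_k}$, where $\varepsilon_k\in\{0,1\}$ and $j=1+\sum_{k=1}^{d-1}\varepsilon_k2^{k-1}$. Let $$m(x)=\Big(m_1(x),\ldots,m_{D/2}(x),\,-m_{D/2}(x)+\tfrac{2s-t}{s},\ldots,-m_1(x)+\tfrac{2s-t}{s}\Big).$$ $\mathcal{I}_{\mathcal{P}}\subseteq\mathbb{Q}[x_1,\ldots,x_{d-1}]$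 is the ideal of polynomials vanishing at $\mathbf{1}_{d-1}=(1,\ldots,1)$ and at $c_j=(1,\ldots,1,-c,1,\ldots,1)$ ($-c$ in position $j$), $j=1,\ldots,d-1$. The classes of $1,x_1,\ldots,x_{d-1}$ form a basis of $\mathbb{Q}[x_1,\ldots,x_{d-1}]/\mathcal{I}_{\mathcal{P}}$; the remainder of a polynomial is the unique element of $\mathrm{span}_{\mathbb{Q}}\{1,x_1,\ldots,x_{d-1}\}$ congruent to it modulo $\mathcal{I}_{\mathcal{P}}$. The fundamental polynomials are, for $2\le n\le d-1$ and $1\le j_1<\cdots<j_n\le d-1$, $F_{j_1,\ldots,j_n}(x)=\prod_{i=1}^nx_{j_i}-\sum_{i=1}^nx_{j_i}+(n-1)$. *)

theory Defs
  imports "HOL-Probability.Probability" "HOL-Library.Poly_Mapping"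
begin

definition cube :: "nat \<Rightarrow> (nat \<Rightarrow> bool) set" where
  "cube d = {1..d} \<rightarrow>\<^sub>E UNIV"

definition bernoulli_class :: "nat \<Rightarrow> real \<Rightarrow> (nat \<Rightarrow> bool) pmf set" where
  "bernoulli_class d p =
     {f. set_pmf f \<subseteq> cube d \<and> (\<forall>k\<in>{1..d}. map_pmf (\<lambda>x. x k) f = bernoulli_pmf p)}"

definition index :: "nat \<Rightarrow> (nat \<Rightarrow> bool) \<Rightarrow> nat" where
  "index d x = 1 + (\<Sum>k=1..d. of_bool (x k) * 2 ^ (k - 1))"

text \<open>The vector \<open>(v 1, \<dots>, v (2 ^ d))\<close> of rationals is the column vector of the pmf
  \<open>f\<close>; such a \<open>v\<close> exists if and only if all entries of \<open>f\<close> are rational.\<close>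

definition is_rat_vector_of :: "nat \<Rightarrow> (nat \<Rightarrow> rat) \<Rightarrow> (nat \<Rightarrow> bool) pmf \<Rightarrow> bool" where
  "is_rat_vector_of d v f \<longleftrightarrow> (\<forall>x\<in>cube d. pmf f x = of_rat (v (index d x)))"

text \<open>A monomial is a finitely supported exponent function, a polynomial a finitely supported
  function from monomials to coefficients.\<close>

type_synonym qpoly = "(nat \<Rightarrow>\<^sub>0 nat) \<Rightarrow>\<^sub>0 rat"

definition Const :: "rat \<Rightarrow> qpoly" where
  "Const a = Poly_Mapping.single 0 a"

definition Var :: "nat \<Rightarrow> qpoly" where
  "Var k = Poly_Mapping.single (Poly_Mapping.single k 1) 1"

definition scale :: "rat \<Rightarrow> qpoly \<Rightarrow> qpoly" where
  "scale a q = Const a * q"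

interpretation qpoly: vector_space scale
  by standard
    (simp_all add: scale_def Const_def distrib_left distrib_right single_add mult_single
      flip: mult.assoc)

definition poly_ring :: "nat \<Rightarrow> qpoly set" where
  "poly_ring n = {q. \<forall>u\<in>Poly_Mapping.keys q. Poly_Mapping.keys u \<subseteq> {1..n}}"

definition eval :: "(nat \<Rightarrow> rat) \<Rightarrow> qpoly \<Rightarrow> rat" where
  "eval y q = (\<Sum>u\<in>Poly_Mapping.keys q. Poly_Mapping.lookup q u *
                 (\<Prod>k\<in>Poly_Mapping.keys u. y k ^ Poly_Mapping.lookup u k))"

text \<open>\<open>bin_digit j k\<close> is the exponent \<open>\<epsilon>\<^sub>k\<close> in
  \<open>j = 1 + (\<Sum>k=1..n. \<epsilon>\<^sub>k * 2 ^ (k - 1))\<close>; see the lemma below.\<close>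

definition bin_digit :: "nat \<Rightarrow> nat \<Rightarrow> nat" where
  "bin_digit j k = (j - 1) div 2 ^ (k - 1) mod 2"

lemma bin_digit_expansion:
  assumes "1 \<le> j" "j \<le> 2 ^ n"
  shows "j = 1 + (\<Sum>k=1..n. bin_digit j k * 2 ^ (k - 1))"
proof -
  have *: "(\<Sum>k=1..n. (i div 2 ^ (k - 1) mod 2) * 2 ^ (k - 1)) = i mod 2 ^ n" for i :: nat
    by (induction n) (simp_all add: mod_mult2_eq mult.commute[of 2])
  show ?thesis
    using assms *[of "j - 1"] by (simp add: bin_digit_def)
qed

definition mono_poly :: "nat \<Rightarrow> nat \<Rightarrow> qpoly" where
  "mono_poly n j = (\<Prod>k=1..n. Var k ^ bin_digit j k)"

definition m_entry :: "nat \<Rightarrow> nat \<Rightarrow> nat \<Rightarrow> nat \<Rightarrow> qpoly" where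
  "m_entry d s t i =
     (if i \<le> 2 ^ (d - 1) then mono_poly (d - 1) i
      else - mono_poly (d - 1) (2 ^ d + 1 - i) + Const ((2 * of_nat s - of_nat t) / of_nat s))"

definition pmf_poly :: "nat \<Rightarrow> nat \<Rightarrow> nat \<Rightarrow> (nat \<Rightarrow> rat) \<Rightarrow> qpoly" where
  "pmf_poly d s t v = (\<Sum>i=1..2 ^ d. scale (v i) (m_entry d s t i))"

definition vanishing_ideal :: "nat \<Rightarrow> rat \<Rightarrow> qpoly set" where
  "vanishing_ideal n c =
     {q \<in> poly_ring n. eval (\<lambda>_. 1) q = 0 \<and>
        (\<forall>j\<in>{1..n}. eval (\<lambda>k. if k = j then - c else 1) q = 0)}"

text \<open>Well defined (existence and uniqueness) on \<open>poly_ring n\<close> whenever \<open>c \<noteq> - 1\<close>.\<close>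

definition remainder :: "nat \<Rightarrow> rat \<Rightarrow> qpoly \<Rightarrow> qpoly" where
  "remainder n c q =
     (THE r. r \<in> qpoly.span (insert 1 (Var ` {1..n})) \<and> q - r \<in> vanishing_ideal n c)"

text \<open>The increasing tuple \<open>j\<^sub>1 < \<dots> < j\<^sub>n\<close> is represented by the set \<open>J\<close> of its entries.\<close>

definition fundamental_poly :: "nat set \<Rightarrow> qpoly" where
  "fundamental_poly J = (\<Prod>j\<in>J. Var j) - (\<Sum>j\<in>J. Var j) + Const (of_nat (card J) - 1)"

definition fundamental_polys :: "nat \<Rightarrow> qpoly set" where
  "fundamental_polys d =
     {fundamental_poly J | J n. n \<in> {2..d - 1} \<and> J \<subseteq> {1..d - 1} \<and> card J = n}"

end

theory Submission
  imports Defs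
begin

text \<open>The polynomial \<open>P\<^sub>f\<close> is multilinear and vanishes at \<open>(1, \<dots>, 1)\<close> and at every \<open>c\<^sub>j\<close>: its
  value at \<open>c\<^sub>j\<close> is the mean of \<open>1 - (1 + c) X\<^sub>j\<close>, and its value at \<open>(1, \<dots>, 1)\<close> is the mean of
  \<open>1 - (1 + c) X\<^sub>d\<close>, both zero since \<open>(1 + c) p = 1\<close>. Replacing every monomial of degree at least
  two by its fundamental polynomial changes \<open>P\<^sub>f\<close> by an affine polynomial vanishing at these
  \<open>d\<close> affinely independent points, hence by zero.\<close>

section \<open>Evaluation of polynomials\<close>

text \<open>\<open>eval\<close> sums over the support, which may shrink under addition or scaling. A
  common finite superset lets linearity be checked term by term.\<close>

lemma eval_superset:
  assumes "finite A" "Poly_Mapping.keys q \<subseteq> A"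
  shows "eval y q = (\<Sum>u\<in>A. Poly_Mapping.lookup q u *
           (\<Prod>k\<in>Poly_Mapping.keys u. y k ^ Poly_Mapping.lookup u k))"
  unfolding eval_def using assms
  by (intro sum.mono_neutral_left) (auto simp: in_keys_iff)

lemma eval_zero [simp]: "eval y 0 = 0"
  by (simp add: eval_def)

lemma eval_add [simp]: "eval y (q + r) = eval y q + eval y r"
proof -
  let ?A = "Poly_Mapping.keys q \<union> Poly_Mapping.keys r"
  show ?thesis
    using Poly_Mapping.keys_add[of q r]
    by (simp add: eval_superset[of ?A] lookup_add distrib_right sum.distrib)
qed

lemma eval_uminus [simp]: "eval y (- q) = - eval y q"
  using eval_add[of y q "- q"] by (simp add: eq_neg_iff_add_eq_0)

lemma eval_diff [simp]: "eval y (q - r) = eval y q - eval y r"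
  using eval_add[of y q "- r"] by simp

lemma lookup_scale: "Poly_Mapping.lookup (scale a q) u = a * Poly_Mapping.lookup q u"
  by (simp add: scale_def Const_def Poly_Mapping.map.rep_eq when_def
      flip: mult_map_scale_conv_mult)

lemma eval_scale [simp]: "eval y (scale a q) = a * eval y q"
proof -
  have "Poly_Mapping.keys (scale a q) \<subseteq> Poly_Mapping.keys q"
    by (auto simp: in_keys_iff lookup_scale)
  then have "eval y (scale a q) = (\<Sum>u\<in>Poly_Mapping.keys q. a * (Poly_Mapping.lookup q u *
           (\<Prod>k\<in>Poly_Mapping.keys u. y k ^ Poly_Mapping.lookup u k)))"
    by (simp add: eval_superset[of "Poly_Mapping.keys q"] lookup_scale mult.assoc)
  then show ?thesis
    by (simp add: eval_def sum_distrib_left)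
qed

lemma eval_sum [simp]: "eval y (\<Sum>i\<in>A. g i) = (\<Sum>i\<in>A. eval y (g i))"
  by (induction A rule: infinite_finite_induct) simp_all

lemma eval_one [simp]: "eval y 1 = 1"
  by (simp add: eval_def)

lemma Const_eq_scale: "Const a = scale a 1"
  by (simp add: scale_def)

lemma eval_Const [simp]: "eval y (Const a) = a"
  by (simp add: Const_eq_scale)

text \<open>A squarefree monomial is a single key with coefficient 1, so its value and its variables
  can be read off directly.\<close>

lemma prod_Var:
  "finite J \<Longrightarrow> (\<Prod>j\<in>J. Var j) = Poly_Mapping.single (\<Sum>j\<in>J. Poly_Mapping.single j 1) 1"
  by (induction J rule: finite_induct) (simp_all add: Var_def mult_single)

lemma lookup_sum_single:
  fixes J :: "'a set"
  assumes "finite J"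
  shows "Poly_Mapping.lookup (\<Sum>j\<in>J. Poly_Mapping.single j (1::nat)) k = of_bool (k \<in> J)"
  using assms
  by (induction J rule: finite_induct) (auto simp: lookup_add lookup_single when_def)

lemma keys_sum_single:
  fixes J :: "'a set"
  assumes "finite J"
  shows "Poly_Mapping.keys (\<Sum>j\<in>J. Poly_Mapping.single j (1::nat)) = J"
  using lookup_sum_single[OF assms] by (auto simp: in_keys_iff)

lemma eval_prod_Var [simp]: "finite J \<Longrightarrow> eval y (\<Prod>j\<in>J. Var j) = (\<Prod>j\<in>J. y j)"
  by (simp add: prod_Var eval_def keys_sum_single[unfolded One_nat_def]
      lookup_sum_single[unfolded One_nat_def])

lemma eval_Var [simp]: "eval y (Var k) = y k"
  using eval_prod_Var[of "{k}"] by simp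

section \<open>Affine polynomials and the vanishing ideal\<close>

lemma poly_ring_add: "q \<in> poly_ring n \<Longrightarrow> r \<in> poly_ring n \<Longrightarrow> q + r \<in> poly_ring n"
  using Poly_Mapping.keys_add[of q r] unfolding poly_ring_def by blast

lemma poly_ring_scale: "q \<in> poly_ring n \<Longrightarrow> scale a q \<in> poly_ring n"
  by (auto simp: poly_ring_def in_keys_iff lookup_scale)

lemma poly_ring_sum: "(\<And>i. i \<in> A \<Longrightarrow> g i \<in> poly_ring n) \<Longrightarrow> (\<Sum>i\<in>A. g i) \<in> poly_ring n"
proof (induction A rule: infinite_finite_induct)
  case (insert x A)
  then show ?case by (simp add: poly_ring_add)
qed (simp_all add: poly_ring_def)

lemma prod_Var_in_poly_ring: "J \<subseteq> {1..n} \<Longrightarrow> (\<Prod>j\<in>J. Var j) \<in> poly_ring n"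
  using finite_subset[of J "{1..n}"]
  by (simp add: poly_ring_def prod_Var keys_sum_single[unfolded One_nat_def])

abbreviation affine_polys :: "nat \<Rightarrow> qpoly set" where
  "affine_polys n \<equiv> qpoly.span (insert 1 (Var ` {1..n}))"

text \<open>Variables are numbered from 1, so index 0 of \<open>b\<close> is free to hold the
  constant term. Each step of the span induction changes one entry of \<open>b\<close>.\<close>

lemma affine_polys_explicit:
  assumes "q \<in> affine_polys n"
  obtains b where "q = Const (b 0) + (\<Sum>j=1..n. scale (b j) (Var j))"
proof -
  have "\<exists>b. q = Const (b 0) + (\<Sum>j=1..n. scale (b j) (Var j))"
    using assms
  proof (induction rule: qpoly.span_induct_alt)
    case base
    show ?case
      by (rule exI[of _ "\<lambda>_. 0"]) (simp add: Const_eq_scale)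
  next
    case (step a x y)
    then obtain b where b: "y = Const (b 0) + (\<Sum>j=1..n. scale (b j) (Var j))"
      by blast
    from step(1) consider "x = 1" | i where "i \<in> {1..n}" "x = Var i"
      by blast
    then show ?case
    proof cases
      case 1
      have "(\<Sum>j=1..n. scale ((b(0 := b 0 + a)) j) (Var j)) = (\<Sum>j=1..n. scale (b j) (Var j))"
        by (intro sum.cong) auto
      then show ?thesis
        using 1 b by (intro exI[of _ "b(0 := b 0 + a)"])
          (simp add: Const_eq_scale qpoly.scale_left_distrib add_ac)
    next
      case (2 i)
      have "(\<Sum>j=1..n. scale ((b(i := b i + a)) j) (Var j)) =
          (\<Sum>j=1..n. scale (b j) (Var j) + (if j = i then scale a (Var i) else 0))"
        by (intro sum.cong) (auto simp: qpoly.scale_left_distrib)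
      also have "\<dots> = (\<Sum>j=1..n. scale (b j) (Var j)) + scale a (Var i)"
        using 2 by (simp add: sum.distrib)
      finally show ?thesis
        using 2 b by (intro exI[of _ "b(i := b i + a)"]) (simp add: add_ac)
    qed
  qed
  with that show thesis by blast
qed

text \<open>The values at (1, ..., 1) and at c_j differ by \<open>b j * (1 + c)\<close>, so every
  linear coefficient vanishes, and then so does the constant term. This is the uniqueness of
  remainders.\<close>

lemma affine_vanishing_eq_0:
  assumes q: "q \<in> affine_polys n" and c: "c \<noteq> - 1"
    and one: "eval (\<lambda>_. 1) q = 0"
    and van: "\<And>j. j \<in> {1..n} \<Longrightarrow> eval (\<lambda>k. if k = j then - c else 1) q = 0"
  shows "q = 0"
proof -
  obtain b where b: "q = Const (b 0) + (\<Sum>j=1..n. scale (b j) (Var j))"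
    using affine_polys_explicit[OF q] .
  have sum0: "b 0 + (\<Sum>j=1..n. b j) = 0"
    using one by (simp add: b)
  have bj: "b j = 0" if j: "j \<in> {1..n}" for j
  proof -
    have "(\<Sum>i=1..n. b i * (if i = j then - c else 1)) =
        (\<Sum>i=1..n. b i - (if i = j then b j * (1 + c) else 0))"
      by (intro sum.cong) (auto simp: algebra_simps)
    also have "\<dots> = (\<Sum>i=1..n. b i) - b j * (1 + c)"
      using j by (simp add: sum_subtractf)
    finally have "b j * (1 + c) = 0"
      using van[OF j] sum0 unfolding b eval_add eval_Const eval_sum eval_scale eval_Var by linarith
    with c show ?thesis
      by (metis add_eq_0_iff mult_eq_0_iff)
  qed
  have "b 0 = 0"
    using sum0 bj by simp
  then show ?thesis
    by (simp add: b bj Const_eq_scale)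
qed

text \<open>Two candidates differ by an affine element of the ideal, which is zero. This resolves
  the \<open>THE\<close> in \<open>remainder\<close>.\<close>

lemma remainder_eqI:
  assumes c: "c \<noteq> - 1" and r: "r \<in> affine_polys n" and qr: "q - r \<in> vanishing_ideal n c"
  shows "remainder n c q = r"
  unfolding remainder_def
proof (rule the_equality)
  fix r' assume r': "r' \<in> affine_polys n \<and> q - r' \<in> vanishing_ideal n c"
  have "r' - r = 0"
    using r r' qr c
    by (intro affine_vanishing_eq_0[of _ n c] qpoly.span_diff)
       (auto simp: vanishing_ideal_def)
  then show "r' = r" by simp
qed (use r qr in auto)

section \<open>Multilinear polynomials\<close>

abbreviation multilinear_polys :: "nat \<Rightarrow> qpoly set" where
  "multilinear_polys n \<equiv> qpoly.span ((\<lambda>J. \<Prod>j\<in>J. Var j) ` Pow {1..n})"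

lemma multilinear_polys_explicit:
  assumes "q \<in> multilinear_polys n"
  obtains \<alpha> where "q = (\<Sum>J\<in>Pow {1..n}. scale (\<alpha> J) (\<Prod>j\<in>J. Var j))"
proof -
  have "\<exists>\<alpha>. q = (\<Sum>J\<in>Pow {1..n}. scale (\<alpha> J) (\<Prod>j\<in>J. Var j))"
    using assms
  proof (induction rule: qpoly.span_induct_alt)
    case base
    show ?case
      by (rule exI[of _ "\<lambda>_. 0"]) simp
  next
    case (step a x y)
    then obtain \<alpha> I where \<alpha>: "y = (\<Sum>J\<in>Pow {1..n}. scale (\<alpha> J) (\<Prod>j\<in>J. Var j))"
      and I: "I \<in> Pow {1..n}" "x = (\<Prod>j\<in>I. Var j)"
      by blast
    have "(\<Sum>J\<in>Pow {1..n}. scale ((\<alpha>(I := \<alpha> I + a)) J) (\<Prod>j\<in>J. Var j)) =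
        (\<Sum>J\<in>Pow {1..n}. scale (\<alpha> J) (\<Prod>j\<in>J. Var j) + (if J = I then scale a x else 0))"
      by (intro sum.cong) (auto simp: I qpoly.scale_left_distrib)
    also have "\<dots> = y + scale a x"
      using I by (simp add: sum.distrib \<alpha>)
    finally show ?case
      by (metis add.commute)
  qed
  with that show thesis by blast
qed

section \<open>Fundamental polynomials as multilinear polynomials in the ideal\<close>

lemma eval_fundamental_poly_one:
  "finite J \<Longrightarrow> eval (\<lambda>_. 1) (fundamental_poly J) = 0"
  by (simp add: fundamental_poly_def)

text \<open>If \<open>j \<in> J\<close>, the product is \<open>- c\<close> and the sum is
  \<open>card J - 1 - c\<close>, which cancel against the constant \<open>card J - 1\<close>.
  Otherwise the point looks like (1, ..., 1) on \<open>J\<close>.\<close>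

lemma eval_fundamental_poly:
  assumes "finite J"
  shows "eval (\<lambda>k. if k = j then - c else 1) (fundamental_poly J) = 0"
proof (cases "j \<in> J")
  case True
  have rest: "(\<Sum>i\<in>J - {j}. if i = j then - c else 1) = (\<Sum>i\<in>J - {j}. 1)"
    "(\<Prod>i\<in>J - {j}. if i = j then - c else 1) = (\<Prod>i\<in>J - {j}. 1)"
    by (intro sum.cong prod.cong; simp)+
  have "of_nat (card J) = 1 + (of_nat (card (J - {j})) :: rat)"
    using card.remove[OF assms True] by simp
  then have "(\<Sum>i\<in>J. if i = j then - c else 1) = of_nat (card J) - 1 - c"
    "(\<Prod>i\<in>J. if i = j then - c else 1) = - c"
    by (simp_all add: sum.remove[OF assms True] prod.remove[OF assms True] rest)
  then show ?thesis
    using assms by (simp add: fundamental_poly_def)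
next
  case False
  have "(\<Sum>i\<in>J. if i = j then - c else 1) = (\<Sum>i\<in>J. 1)"
    "(\<Prod>i\<in>J. if i = j then - c else 1) = (\<Prod>i\<in>J. 1)"
    using False by (intro sum.cong prod.cong; force)+
  then show ?thesis
    using assms by (simp add: fundamental_poly_def)
qed

text \<open>The leading products cancel, so exchanging a monomial for its fundamental polynomial
  alters only the affine part.\<close>

lemma prod_Var_minus_fundamental_affine:
  assumes "J \<subseteq> {1..n}"
  shows "(\<Prod>j\<in>J. Var j) - fundamental_poly J \<in> affine_polys n"
proof -
  have "(\<Prod>j\<in>J. Var j) - fundamental_poly J =
      (\<Sum>j\<in>J. Var j) - scale (of_nat (card J) - 1) 1"
    by (simp add: fundamental_poly_def Const_eq_scale)
  also have "\<dots> \<in> affine_polys n"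
    using assms
    by (intro qpoly.span_diff qpoly.span_sum qpoly.span_scale qpoly.span_base) auto
  finally show ?thesis .
qed

lemma prod_Var_affine:
  assumes "J \<subseteq> {1..n}" "card J < 2"
  shows "(\<Prod>j\<in>J. Var j) \<in> affine_polys n"
proof -
  have "finite J"
    using assms finite_subset by blast
  with assms have "J = {} \<or> (\<exists>j\<in>{1..n}. J = {j})"
    by (auto simp: less_2_cases_iff card_1_singleton_iff)
  then show ?thesis
    by (auto intro: qpoly.span_base)
qed

text \<open>The monomial coefficients of \<open>q\<close> in degree at least two serve unchanged as
  coefficients of the fundamental polynomials. The leftover \<open>L\<close> is affine and inherits
  the zeros of \<open>q\<close>.\<close>

lemma multilinear_vanishing:
  assumes q: "q \<in> multilinear_polys n" and c: "c \<noteq> - 1"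
    and one: "eval (\<lambda>_. 1) q = 0"
    and van: "\<And>j. j \<in> {1..n} \<Longrightarrow> eval (\<lambda>k. if k = j then - c else 1) q = 0"
  obtains \<alpha> where
    "q = (\<Sum>J | J \<subseteq> {1..n} \<and> 2 \<le> card J. scale (\<alpha> J) (fundamental_poly J))"
proof -
  obtain \<alpha> where \<alpha>: "q = (\<Sum>J\<in>Pow {1..n}. scale (\<alpha> J) (\<Prod>j\<in>J. Var j))"
    using multilinear_polys_explicit[OF q] .
  define S where "S = {J. J \<subseteq> {1..n} \<and> 2 \<le> card J}"
  define L where "L = q - (\<Sum>J\<in>S. scale (\<alpha> J) (fundamental_poly J))"
  have finS: "finite J" if "J \<in> S" for J
    using that finite_subset by (auto simp: S_def)
  have "S \<subseteq> Pow {1..n}"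
    by (auto simp: S_def)
  \<comment> \<open>The first sum consists of the terms of degree below two; the second collects the
    affine corrections left by the exchange.\<close>
  then have "L = (\<Sum>J\<in>Pow {1..n} - S. scale (\<alpha> J) (\<Prod>j\<in>J. Var j)) +
      (\<Sum>J\<in>S. scale (\<alpha> J) ((\<Prod>j\<in>J. Var j) - fundamental_poly J))"
    unfolding L_def \<alpha>
    by (subst sum.subset_diff[of S "Pow {1..n}"])
       (simp_all add: qpoly.scale_right_diff_distrib sum_subtractf)
  also have "\<dots> \<in> affine_polys n"
    by (intro qpoly.span_add qpoly.span_sum qpoly.span_scale prod_Var_minus_fundamental_affine
          prod_Var_affine) (auto simp: S_def)
  finally have "L = 0"
    using c one van finS
    by (intro affine_vanishing_eq_0[of L n c])
       (simp_all add: L_def eval_fundamental_poly_one eval_fundamental_poly)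
  then show thesis
    using that[of \<alpha>] by (simp add: L_def S_def)
qed

section \<open>Binary digits\<close>

lemma bin_digit_cases: "bin_digit i k = 0 \<or> bin_digit i k = 1"
  by (auto simp: bin_digit_def)

text \<open>As \<open>i - 1 < 2 ^ d\<close>, the top quotient is already below 2, so reduction
  modulo 2 does nothing.\<close>

lemma bin_digit_top_eq_0_iff:
  assumes "0 < d" "1 \<le> i" "i \<le> 2 ^ d"
  shows "bin_digit i d = 0 \<longleftrightarrow> i \<le> 2 ^ (d - 1)"
proof -
  have "(i - 1) div 2 ^ (d - 1) < 2"
    using assms by (intro less_mult_imp_div_less) (cases d; auto)
  then have "bin_digit i d = (i - 1) div 2 ^ (d - 1)"
    by (simp add: bin_digit_def)
  then show ?thesis
    using assms by (auto simp: div_eq_0_iff)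
qed

text \<open>With the offset removed, \<open>2 ^ d + 1 - i\<close> stands for
  \<open>(2 ^ d - 1) - (i - 1)\<close>. Subtracting from a string of ones flips each digit without
  borrowing. This governs the mirrored second half of m(x).\<close>

lemma bin_digit_complement:
  assumes "1 \<le> k" "k \<le> d" "1 \<le> i" "i \<le> 2 ^ d"
  shows "bin_digit (2 ^ d + 1 - i) k = 1 - bin_digit i k"
proof -
  define B :: nat where "B = 2 ^ (k - 1)"
  define M :: nat where "M = 2 ^ (d - k)"
  define u where "u = (i - 1) div B"
  define r where "r = (i - 1) mod B"
  have "(2::nat) ^ d = 2 ^ Suc ((d - k) + (k - 1))"
    using assms by (intro arg_cong[of _ _ "(^) 2"]) auto
  then have D: "2 ^ d = 2 * M * B"
    by (simp add: M_def B_def power_add)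
  have B: "0 < B" by (simp add: B_def)
  have i: "i = u * B + r + 1" and r: "r < B"
    using assms B by (simp_all add: u_def r_def)
  have "u < 2 * M"
    using assms B unfolding u_def D by (intro less_mult_imp_div_less) auto
  \<comment> \<open>\<open>w\<close> is \<open>2 * M - 1 - u\<close>, the quotient after
    complementing. Since \<open>u + w\<close> is odd, the last digits of \<open>u\<close> and
    \<open>w\<close> are opposite.\<close>
  then obtain w where w: "2 * M = u + 1 + w"
    by (metis less_iff_Suc_add add_Suc_right Suc_eq_plus1 add.commute add.left_commute)
  have "2 ^ d + 1 - i - 1 = w * B + (B - 1 - r)"
    unfolding D w i using r by (simp add: algebra_simps)
  then have "(2 ^ d + 1 - i - 1) div B = w"
    using B by (simp add: div_add1_eq)
  moreover have "w mod 2 = 1 - u mod 2"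
    using arg_cong[OF w, of even] by (auto simp: mod_2_eq_odd)
  ultimately show ?thesis
    by (simp only: bin_digit_def u_def flip: B_def)
qed

text \<open>The inverse of \<open>index d\<close> on \<open>{1..2 ^ d}\<close>. The restricted
  abstraction is needed because \<open>cube d\<close> consists of extensional functions.\<close>

definition bits :: "nat \<Rightarrow> nat \<Rightarrow> nat \<Rightarrow> bool" where
  "bits d i = (\<lambda>k\<in>{1..d}. bin_digit i k = 1)"

lemma bits_eq: "k \<in> {1..d} \<Longrightarrow> bits d i k \<longleftrightarrow> bin_digit i k = 1"
  by (simp add: bits_def)

lemma index_bits:
  assumes "i \<in> {1..2 ^ d}"
  shows "index d (bits d i) = i"
proof -
  have "of_bool (bits d i k) = bin_digit i k" if "k \<in> {1..d}" for k
    using bin_digit_cases[of i k] that by (auto simp: bits_eq)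
  then have "index d (bits d i) = 1 + (\<Sum>k=1..d. bin_digit i k * 2 ^ (k - 1))"
    unfolding index_def by (intro arg_cong[of _ _ "(+) 1"] sum.cong) auto
  then show ?thesis
    using assms bin_digit_expansion[of i d] by simp
qed

text \<open>Injectivity comes from the left inverse \<open>index d\<close>, surjectivity from equal
  cardinalities.\<close>

lemma bij_betw_bits: "bij_betw (bits d) {1..2 ^ d} (cube d)"
proof -
  have inj: "inj_on (bits d) {1..2 ^ d}"
    by (rule inj_on_inverseI[of _ "index d"]) (rule index_bits)
  have sub: "bits d ` {1..2 ^ d} \<subseteq> cube d"
    by (auto simp: bits_def cube_def)
  have "finite (cube d)" "card (cube d) = 2 ^ d"
    by (auto simp: cube_def card_PiE intro!: finite_PiE)
  then have "bits d ` {1..2 ^ d} = cube d"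
    using sub card_image[OF inj] by (intro card_subset_eq) (simp_all del: One_nat_def)
  with inj show ?thesis
    by (simp add: bij_betw_def)
qed

section \<open>The polynomial of a probability mass function\<close>

lemma mono_poly_eq_prod:
  "mono_poly n i = (\<Prod>k | k \<in> {1..n} \<and> bin_digit i k = 1. Var k)"
proof -
  have "mono_poly n i = (\<Prod>k=1..n. if bin_digit i k = 1 then Var k else 1)"
    unfolding mono_poly_def
    by (intro prod.cong refl) (metis bin_digit_cases power_0 power_one_right)
  also have "\<dots> = (\<Prod>k\<in>{1..n} \<inter> {k. bin_digit i k = 1}. Var k)"
    by (simp add: prod.inter_restrict)
  finally show ?thesis
    by (simp add: Int_def)
qed

lemma pmf_poly_multilinear: "pmf_poly d s t v \<in> multilinear_polys (d - 1)"
proof -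
  have mono: "mono_poly (d - 1) i \<in> multilinear_polys (d - 1)" for i
    unfolding mono_poly_eq_prod by (rule qpoly.span_base) auto
  have "1 \<in> multilinear_polys (d - 1)"
    by (rule qpoly.span_base) (auto intro: image_eqI[of _ _ "{}"])
  then have "m_entry d s t i \<in> multilinear_polys (d - 1)" for i
    unfolding m_entry_def Const_eq_scale using mono
    by (metis qpoly.span_add qpoly.span_neg qpoly.span_scale)
  then show ?thesis
    unfolding pmf_poly_def by (intro qpoly.span_sum qpoly.span_scale)
qed

lemma eval_mono_poly:
  "eval y (mono_poly n i) = (\<Prod>k=1..n. if bin_digit i k = 1 then y k else 1)"
proof -
  have "eval y (mono_poly n i) = (\<Prod>k | k \<in> {1..n} \<and> bin_digit i k = 1. y k)"
    by (simp add: mono_poly_eq_prod)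
  also have "{k. k \<in> {1..n} \<and> bin_digit i k = 1} = {1..n} \<inter> {k. bin_digit i k = 1}"
    by auto
  also have "(\<Prod>k\<in>\<dots>. y k) = (\<Prod>k=1..n. if bin_digit i k = 1 then y k else 1)"
    by (simp add: prod.inter_restrict)
  finally show ?thesis .
qed

lemma eval_mono_poly_one: "eval (\<lambda>_. 1) (mono_poly n i) = 1"
  by (simp add: eval_mono_poly)

lemma eval_mono_poly_point:
  assumes "j \<in> {1..n}"
  shows "eval (\<lambda>k. if k = j then a else 1) (mono_poly n i) =
    (if bin_digit i j = 1 then a else 1)"
proof -
  have "eval (\<lambda>k. if k = j then a else 1) (mono_poly n i) =
      (\<Prod>k=1..n. if k = j then (if bin_digit i j = 1 then a else 1) else 1)"
    unfolding eval_mono_poly by (intro prod.cong) auto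
  then show ?thesis
    using assms by simp
qed

section \<open>Values of P_f at the defining points of the ideal\<close>

context
  fixes d s t :: nat and p c :: rat and f :: "(nat \<Rightarrow> bool) pmf" and v :: "nat \<Rightarrow> rat"
  assumes d: "d \<ge> 2" and s: "s > 0" and t: "t > 0"
    and p: "p = of_nat s / of_nat t" and p0: "0 < p" and p_half: "p \<le> 1 / 2"
    and c: "c = (1 - p) / p"
    and f: "f \<in> bernoulli_class d (of_rat p)"
    and v: "is_rat_vector_of d v f"
begin

text \<open>In the second half of m(x) the monomial carries the complemented digits of
  \<open>i\<close>, and the map \<open>x\<close> to \<open>1 - c - x\<close> swaps 1 and
  \<open>- c\<close>, undoing the complement. So both halves obey one rule: c_j reads digit
  \<open>j\<close> of \<open>i\<close>, and (1, ..., 1) reads the top digit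
  \<open>d\<close>.\<close>

lemma eval_m_entry:
  assumes "i \<in> {1..2 ^ d}"
  shows "eval (\<lambda>_. 1) (m_entry d s t i) = (if bin_digit i d = 1 then - c else 1)"
    and "j \<in> {1..d - 1} \<Longrightarrow> eval (\<lambda>k. if k = j then - c else 1) (m_entry d s t i) =
      (if bin_digit i j = 1 then - c else 1)"
proof -
  \<comment> \<open>The constant added in the second half is the sum of the two possible values 1
    and \<open>- c\<close>.\<close>
  have const: "(2 * of_nat s - of_nat t) / of_nat s = 1 - c"
    using s t by (simp add: c p field_simps)
  have top: "i \<le> 2 ^ (d - 1) \<longleftrightarrow> bin_digit i d \<noteq> 1"
    using bin_digit_top_eq_0_iff[of d i] bin_digit_cases[of i d] d assms by auto
  show "eval (\<lambda>_. 1) (m_entry d s t i) = (if bin_digit i d = 1 then - c else 1)"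
    using bin_digit_cases[of i d]
    by (simp only: m_entry_def top const eval_mono_poly_one eval_add eval_uminus eval_Const if_distrib)
       auto
  show "eval (\<lambda>k. if k = j then - c else 1) (m_entry d s t i) =
      (if bin_digit i j = 1 then - c else 1)" if j: "j \<in> {1..d - 1}"
  proof -
    have "bin_digit (2 ^ d + 1 - i) j = 1 - bin_digit i j"
      using assms j by (intro bin_digit_complement) auto
    then show ?thesis
      using j bin_digit_cases[of i j]
      by (auto simp: m_entry_def top const eval_mono_poly_point)
  qed
qed

text \<open>The sum is the mean of \<open>1 - (1 + c) * X_j\<close>, that is
  \<open>1 - (1 + c) * p\<close>, and \<open>1 + c = 1 / p\<close>. It is computed over the reals on
  the cube and pulled back by injectivity of \<open>of_rat\<close>.\<close>

lemma marginal_sum: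
  assumes j: "j \<in> {1..d}"
  shows "(\<Sum>i=1..2 ^ d. v i * (if bin_digit i j = 1 then - c else 1)) = 0"
proof -
  have fin: "finite (cube d)" and sub: "set_pmf f \<subseteq> cube d"
    using f by (auto simp: cube_def bernoulli_class_def intro!: finite_PiE)
  \<comment> \<open>These bounds allow the mass of \<open>bernoulli_pmf\<close> at
    \<open>True\<close> to be evaluated.\<close>
  have p1: "0 \<le> (of_rat p :: real)" "(of_rat p :: real) \<le> 1"
    using p0 p_half of_rat_less_eq[of p 1, where ?'a = real] by simp_all
  have v_eq: "of_rat (v i) = pmf f (bits d i)" if "i \<in> {1..2 ^ d}" for i
    using v that index_bits[OF that] bij_betw_apply[OF bij_betw_bits that]
    by (simp add: is_rat_vector_of_def)
  have total: "(\<Sum>x\<in>cube d. pmf f x) = 1"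
    using fin sub by (rule sum_pmf_eq_1)
  have "of_rat p = pmf (map_pmf (\<lambda>x. x j) f) True"
    using f j p1 by (simp add: bernoulli_class_def)
  also have "\<dots> = measure f {x. x j}"
    by (simp add: pmf_map vimage_def)
  also have "\<dots> = measure f (cube d \<inter> {x. x j})"
    using sub by (intro measure_pmf.finite_measure_eq_AE) (auto simp: AE_measure_pmf_iff)
  also have "\<dots> = (\<Sum>x\<in>cube d. if x j then pmf f x else 0)"
    using fin by (simp add: measure_measure_pmf_finite sum.inter_restrict)
  finally have marg: "(\<Sum>x\<in>cube d. if x j then pmf f x else 0) = of_rat p" ..
  have "of_rat (\<Sum>i=1..2 ^ d. v i * (if bin_digit i j = 1 then - c else 1)) =
      (\<Sum>i=1..2 ^ d. pmf f (bits d i) * (if bits d i j then - of_rat c else 1))"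
    unfolding of_rat_sum
    by (intro sum.cong) (use j in \<open>auto simp: of_rat_mult of_rat_minus v_eq bits_eq\<close>)
  also have "\<dots> = (\<Sum>x\<in>cube d. pmf f x * (if x j then - of_rat c else 1))"
    by (rule sum.reindex_bij_betw[OF bij_betw_bits])
  also have "\<dots> = (\<Sum>x\<in>cube d. pmf f x - (1 + of_rat c) * (if x j then pmf f x else 0))"
    by (intro sum.cong) (auto simp: algebra_simps)
  also have "\<dots> = 1 - (1 + of_rat c) * of_rat p"
    by (simp add: sum_subtractf total marg flip: sum_distrib_left)
  also have "\<dots> = of_rat (1 - (1 + c) * p)"
    by (simp add: of_rat_diff of_rat_mult of_rat_add)
  also have "1 - (1 + c) * p = 0"
    using p0 by (simp add: c field_simps)
  finally show ?thesis
    by simp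
qed

lemma eval_pmf_poly:
  shows "eval (\<lambda>_. 1) (pmf_poly d s t v) = 0"
    and "j \<in> {1..d - 1} \<Longrightarrow> eval (\<lambda>k. if k = j then - c else 1) (pmf_poly d s t v) = 0"
  using d marginal_sum[of d] marginal_sum[of j]
  by (auto simp: pmf_poly_def eval_m_entry)

end

theorem corollary3p1:
  fixes d s t :: nat and p c :: rat and f :: "(nat \<Rightarrow> bool) pmf" and v :: "nat \<Rightarrow> rat"
  assumes "d \<ge> 2" and "s > 0" and "t > 0"
    and "p = of_nat s / of_nat t" and "0 < p" and "p \<le> 1 / 2"
    and "c = (1 - p) / p"
    and "f \<in> bernoulli_class d (of_rat p)"
    and "is_rat_vector_of d v f"
  shows "pmf_poly d s t v \<in> qpoly.span (fundamental_polys d) \<and>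
    (\<exists>(a :: nat set \<Rightarrow> rat) (b :: nat \<Rightarrow> rat) Q R.
       Q = (\<Sum>k=2..d - 1. \<Sum>J | J \<subseteq> {1..d - 1} \<and> card J = k. scale (a J) (\<Prod>j\<in>J. Var j)) \<and>
       R = Const (b 0) + (\<Sum>j=1..d - 1. scale (b j) (Var j)) \<and>
       R = remainder (d - 1) c Q \<and>
       pmf_poly d s t v = Q - R)"
proof -
  define n where "n = d - 1"
  define P where "P = pmf_poly d s t v"
  define S where "S = {J. J \<subseteq> {1..n} \<and> 2 \<le> card J}"
  note vanish = eval_pmf_poly[OF assms, folded P_def n_def]
  have c: "c \<noteq> - 1"
    using assms(5,7) by (auto simp: field_simps)
  obtain \<alpha> where \<alpha>: "P = (\<Sum>J\<in>S. scale (\<alpha> J) (fundamental_poly J))"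
    using multilinear_vanishing[OF pmf_poly_multilinear[of d s t v, folded P_def n_def] c vanish]
    unfolding S_def by blast
  \<comment> \<open>This bound lets the terms be grouped by degree over \<open>{2..n}\<close>. For
    \<open>d = 2\<close> this range and \<open>S\<close> are empty and \<open>P\<close> is
    zero.\<close>
  have card: "card J \<le> n" if "J \<subseteq> {1..n}" for J
    using card_mono[OF _ that] by simp
  \<comment> \<open>Each fundamental polynomial has exactly one monomial of degree at least two, so
    \<open>Q\<close> is the part of \<open>P\<close> in those degrees.\<close>
  define Q where "Q = (\<Sum>J\<in>S. scale (\<alpha> J) (\<Prod>j\<in>J. Var j))"
  have "finite S"
    by (rule finite_subset[of _ "Pow {1..n}"]) (auto simp: S_def)
  then have Q: "Q = (\<Sum>k=2..n. \<Sum>J | J \<subseteq> {1..n} \<and> card J = k. scale (\<alpha> J) (\<Prod>j\<in>J. Var j))"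
    unfolding Q_def using card
    by (subst sum.group[of S "{2..n}" card, symmetric])
       (auto simp: S_def intro!: sum.cong)
  have QP: "Q - P \<in> affine_polys n"
    unfolding Q_def \<alpha> sum_subtractf[symmetric] qpoly.scale_right_diff_distrib[symmetric]
    by (intro qpoly.span_sum qpoly.span_scale prod_Var_minus_fundamental_affine)
       (simp add: S_def)
  obtain b where b: "Q - P = Const (b 0) + (\<Sum>j=1..n. scale (b j) (Var j))"
    using affine_polys_explicit[OF QP] .
  \<comment> \<open>Besides the zeros, the ideal requires that only the variables
    \<open>1..n\<close> occur.\<close>
  have "P \<in> poly_ring n"
    using multilinear_polys_explicit[OF pmf_poly_multilinear[of d s t v, folded P_def n_def]]
    by (metis (no_types, lifting) PowD poly_ring_scale poly_ring_sum prod_Var_in_poly_ring)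
  then have "P \<in> vanishing_ideal n c"
    using vanish by (simp add: vanishing_ideal_def)
  \<comment> \<open>\<open>Q - P\<close> is affine and differs from \<open>Q\<close> by
    \<open>P\<close>, which lies in the ideal; hence it serves as R.\<close>
  then have "remainder n c Q = Q - P"
    using c QP by (intro remainder_eqI) simp_all
  moreover have "P \<in> qpoly.span (fundamental_polys d)"
    unfolding \<alpha> using card
    by (intro qpoly.span_sum qpoly.span_scale qpoly.span_base)
       (auto simp: S_def fundamental_polys_def n_def)
  moreover have "P = Q - (Q - P)"
    by simp
  ultimately have "P \<in> qpoly.span (fundamental_polys d) \<and>
      Q = (\<Sum>k=2..n. \<Sum>J | J \<subseteq> {1..n} \<and> card J = k. scale (\<alpha> J) (\<Prod>j\<in>J. Var j)) \<and>
      Q - P = Const (b 0) + (\<Sum>j=1..n. scale (b j) (Var j)) \<and>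
      Q - P = remainder n c Q \<and> P = Q - (Q - P)"
    using Q b by (intro conjI; simp only:)
  then show ?thesis
    unfolding P_def n_def by blast
qed

end
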